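(* Let $K>0$ be a constant with the following property: for every finite set $X$ and every non-trivial increasing family $\mathcal F \subset \mathcal P(X)$ with $l(\mathcal F) \ge 2$, one has $p_\mathrm{c}(\mathcal F) \le K\, q_\mathrm{c}(\mathcal F) \log_2 l(\mathcal F)$. Then for every finite set $X$ and every non-trivial increasing family $\mathcal F \subset \mathcal P(X)$ with $l(\mathcal F) \ge 2$, \[ p_\mathrm{c}(\mathcal F) \le 1 - \mathrm{e}^{-K q_\mathrm{c}(\mathcal F) \log_2 l(\mathcal F)}. \]
   Context: For a finite set $X$ and $p\in[0,1]$, $X_p$ denotes the random subset of $X$ containing each element independently with probability $p$. A family $\mathcal F\subset\mathcal P(X)$ is increasing if $A\in\mathcal F$ and $A\subset B\subset X$ imply $B\in\mathcal F$; it is non-trivial if $\mathcal F\neq\emptyset$ and $\mathcal F\neq \mathcal P(X)$. The threshold $p_\mathrm{c}(\mathcal F)$ is the unique $p\in(0,1)$ with $\mathbb P(X_p\in\mathcal F)=1/2$. For $\mathcal G\subset\mathcal P(X)$ and $q\in[0,1]$, $\mathrm{cost}_q(\mathcal G)=\sum_{S\in\mathcal G} q^{|S|}$; $\mathcal G$ is $q$-cheap if $\mathrm{cost}_q(\mathcal G)\le 1/2$; $\mathcal G$ covers $\mathcal F$ if every $T\in\mathcal F$ contains some $S\in\mathcal G$. The expectation threshold is $q_\mathrm{c}(\mathcal F)=\sup\{q\in[0,1]: \text{there exists a } q\text{-cheap cover of } \mathcal F\}$. $l(\mathcal F)$ denotes the size of a largest minimal element of $\mathcal F$. (By the Park–Pham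 theorem such a universal constant $K$ exists.) *)

theory Defs
  imports "HOL-Probability.Probability"
begin

definition random_subset :: "'a set \<Rightarrow> real \<Rightarrow> 'a set pmf" where
  "random_subset X p =
     map_pmf (\<lambda>f. {x \<in> X. f x}) (Pi_pmf X False (\<lambda>_. bernoulli_pmf p))"

definition increasing_family :: "'a set \<Rightarrow> 'a set set \<Rightarrow> bool" where
  "increasing_family X F \<longleftrightarrow>
     F \<subseteq> Pow X \<and> (\<forall>A B. A \<in> F \<longrightarrow> A \<subseteq> B \<longrightarrow> B \<subseteq> X \<longrightarrow> B \<in> F)"

definition nontrivial_family :: "'a set \<Rightarrow> 'a set set \<Rightarrow> bool" where
  "nontrivial_family X F \<longleftrightarrow> F \<noteq> {} \<and> F \<noteq> Pow X"

definition threshold :: "'a set \<Rightarrow> 'a set set \<Rightarrow> real" where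
  "threshold X F =
     (THE p. 0 < p \<and> p < 1 \<and> measure_pmf.prob (random_subset X p) F = 1 / 2)"

definition cost :: "real \<Rightarrow> 'a set set \<Rightarrow> real" where
  "cost q G = (\<Sum>S\<in>G. q ^ card S)"

definition cheap :: "real \<Rightarrow> 'a set set \<Rightarrow> bool" where
  "cheap q G \<longleftrightarrow> cost q G \<le> 1 / 2"

definition covers :: "'a set set \<Rightarrow> 'a set set \<Rightarrow> bool" where
  "covers G F \<longleftrightarrow> (\<forall>T\<in>F. \<exists>S\<in>G. S \<subseteq> T)"

definition expectation_threshold :: "'a set \<Rightarrow> 'a set set \<Rightarrow> real" where
  "expectation_threshold X F =
     Sup {q \<in> {0..1}. \<exists>G. G \<subseteq> Pow X \<and> cheap q G \<and> covers G F}"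

definition minimal_elements :: "'a set set \<Rightarrow> 'a set set" where
  "minimal_elements F = {A \<in> F. \<forall>B\<in>F. B \<subseteq> A \<longrightarrow> B = A}"

definition largest_minimal_size :: "'a set set \<Rightarrow> nat" where
  "largest_minimal_size F = Max (card ` minimal_elements F)"

end

theory Submission
  imports Defs
begin

text \<open>
  Replace every point of \<open>X\<close> by \<open>N\<close> copies and let \<open>F'\<close> be the family of those sets of copies
  whose projection to \<open>X\<close> lies in \<open>F\<close>. The minimal elements keep their sizes, and the projection of
  a \<open>p'\<close>-random set of copies is a \<open>(1 - (1 - p')^N)\<close>-random subset of \<open>X\<close>, so the thresholds satisfy
  \<open>1 - p = (1 - p')^N\<close>. Restricting a \<open>q'\<close>-cheap cover of \<open>F'\<close> to a uniformly random choice of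
  one copy per point gives a cover of \<open>F\<close> whose expected cost at \<open>N q'\<close> is at most \<open>1/2\<close>; hence
  the expectation threshold drops by the factor \<open>N\<close>. The hypothesis for \<open>F'\<close> thus reads \<open>p' \<le> c / N\<close>
  with \<open>c = K q log l\<close>, and \<open>1 - p \<ge> (1 - c / N)^N\<close> tends to \<open>exp (- c)\<close>.
\<close>

section \<open>Random subsets\<close>

lemma pmf_random_subset:
  assumes "finite X" "A \<subseteq> X" "0 \<le> p" "p \<le> 1"
  shows "pmf (random_subset X p) A = p ^ card A * (1 - p) ^ card (X - A)"
proof -
  let ?P = "Pi_pmf X False (\<lambda>_. bernoulli_pmf p)"
  have "pmf (random_subset X p) A = measure_pmf.prob ?P ((\<lambda>f. {x \<in> X. f x}) -` {A})"
    unfolding random_subset_def pmf_map ..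
  \<comment> \<open>A function true somewhere outside \<open>X\<close> has mass 0, since the product
    takes the default value \<open>False\<close> there. Hence only the indicator of \<open>A\<close>
    counts in the preimage.\<close>
  also have "\<dots> = measure_pmf.prob ?P {\<lambda>x. x \<in> A}"
  proof (rule measure_prob_cong_0)
    fix f assume f: "f \<in> (\<lambda>f. {x \<in> X. f x}) -` {A} - {\<lambda>x. x \<in> A}"
    then obtain x where "x \<notin> X" "f x"
      by fastforce
    then show "pmf ?P f = 0"
      using assms by (intro pmf_Pi_outside) auto
  qed (use assms in auto)
  also have "\<dots> = pmf ?P (\<lambda>x. x \<in> A)"
    by (simp add: measure_pmf_single)
  also have "\<dots> = (\<Prod>x\<in>X. pmf (bernoulli_pmf p) (x \<in> A))"
    using assms by (intro pmf_Pi') auto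
  also have "\<dots> = (\<Prod>x\<in>A. pmf (bernoulli_pmf p) (x \<in> A)) * (\<Prod>x\<in>X - A. pmf (bernoulli_pmf p) (x \<in> A))"
    using assms by (metis prod.subset_diff mult.commute)
  also have "\<dots> = p ^ card A * (1 - p) ^ card (X - A)"
    using assms by simp
  finally show ?thesis .
qed

lemma set_pmf_random_subset: "set_pmf (random_subset X p) \<subseteq> Pow X"
  by (auto simp: random_subset_def)

lemma random_subset_empty [simp]: "random_subset {} p = return_pmf {}"
  by (simp add: random_subset_def)

text \<open>Independence of the coins on disjoint sets; it lets single points, and later whole
  fibres, be added one at a time.\<close>

lemma random_subset_Un:
  assumes "finite A" "finite B" "A \<inter> B = {}"
  shows "random_subset (A \<union> B) p =
    map_pmf (\<lambda>(S, T). S \<union> T) (pair_pmf (random_subset A p) (random_subset B p))"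
proof -
  have "random_subset (A \<union> B) p = map_pmf (\<lambda>(f, g). {x \<in> A. f x} \<union> {x \<in> B. g x})
    (pair_pmf (Pi_pmf A False (\<lambda>_. bernoulli_pmf p)) (Pi_pmf B False (\<lambda>_. bernoulli_pmf p)))"
    unfolding random_subset_def Pi_pmf_union[OF assms] map_pmf_comp
    using assms(3) by (intro map_pmf_cong refl) auto
  then show ?thesis
    by (simp add: random_subset_def map_pmf_comp case_prod_unfold
        flip: map_pair)
qed

lemma random_subset_singleton:
  "random_subset {x} p = map_pmf (\<lambda>b. if b then {x} else {}) (bernoulli_pmf p)"
  by (auto simp: random_subset_def Pi_pmf_singleton map_pmf_comp split: if_splits
      intro!: map_pmf_cong)

text \<open>Condition on the coin of \<open>x\<close>: on success the rest must lie in the link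
  \<open>{A. insert x A \<in> F}\<close>, otherwise in \<open>F\<close> itself. This drives both
  monotonicity inductions.\<close>

lemma prob_random_subset_insert:
  assumes "finite X" "x \<notin> X" "0 \<le> p" "p \<le> 1"
  shows "measure_pmf.prob (random_subset (insert x X) p) F =
    p * measure_pmf.prob (random_subset X p) {A. insert x A \<in> F} +
    (1 - p) * measure_pmf.prob (random_subset X p) F"
proof -
  have "random_subset (insert x X) p =
    bind_pmf (bernoulli_pmf p) (\<lambda>b. map_pmf (\<lambda>A. if b then insert x A else A) (random_subset X p))"
    using random_subset_Un[of "{x}" X p] assms
    by (auto simp: random_subset_singleton pair_pmf_def map_pmf_def bind_assoc_pmf
        bind_return_pmf intro!: bind_pmf_cong)
  then have "map_pmf (\<lambda>A. A \<in> F) (random_subset (insert x X) p) = bind_pmf (bernoulli_pmf p)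
      (\<lambda>b. map_pmf (\<lambda>A. (if b then insert x A else A) \<in> F) (random_subset X p))"
    by (simp add: map_bind_pmf map_pmf_comp)
  then have "pmf (map_pmf (\<lambda>A. A \<in> F) (random_subset (insert x X) p)) True =
      p * pmf (map_pmf (\<lambda>A. insert x A \<in> F) (random_subset X p)) True +
      (1 - p) * pmf (map_pmf (\<lambda>A. A \<in> F) (random_subset X p)) True"
    using assms by (simp add: pmf_bind)
  then show ?thesis
    by (simp add: pmf_map vimage_def)
qed

text \<open>All coins fail with probability \<open>(1 - p) ^ card X\<close>. Applied to a fibre,
  this is the law of the event that at least one copy of a point is chosen.\<close>

lemma map_nonempty_random_subset:
  assumes "finite X" "0 \<le> p" "p \<le> 1"
  shows "map_pmf (\<lambda>S. S \<noteq> {}) (random_subset X p) = bernoulli_pmf (1 - (1 - p) ^ card X)"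
proof (rule pmf_eqI)
  have le: "(1 - p) ^ card X \<le> 1" "0 \<le> (1 - p) ^ card X"
    using assms by (auto intro: power_le_one)
  have "pmf (map_pmf (\<lambda>S. S \<noteq> {}) (random_subset X p)) False = pmf (random_subset X p) {}"
    by (simp add: pmf_map vimage_def measure_pmf_single)
  then have F: "pmf (map_pmf (\<lambda>S. S \<noteq> {}) (random_subset X p)) False = (1 - p) ^ card X"
    using assms by (simp add: pmf_random_subset)
  show "pmf (map_pmf (\<lambda>S. S \<noteq> {}) (random_subset X p)) b =
    pmf (bernoulli_pmf (1 - (1 - p) ^ card X)) b" for b
    using F le by (cases b) (simp_all add: pmf_False_conv_True)
qed

section \<open>The threshold\<close>

text \<open>Almost surely \<open>A \<subseteq> X\<close>, so upward closure lets \<open>x\<close> be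
  added to any \<open>A\<close> in \<open>F\<close>. This supplies the hypothesis
  \<open>b \<le> a\<close> of the two lemmas that follow.\<close>

lemma prob_random_subset_le_link:
  assumes "\<And>A B. A \<in> F \<Longrightarrow> A \<subseteq> B \<Longrightarrow> B \<subseteq> insert x X \<Longrightarrow> B \<in> F"
  shows "measure_pmf.prob (random_subset X p) F
    \<le> measure_pmf.prob (random_subset X p) {A. insert x A \<in> F}"
proof (intro measure_pmf.finite_measure_mono_AE AE_pmfI impI)
  fix A assume "A \<in> set_pmf (random_subset X p)" "A \<in> F"
  then show "A \<in> {A. insert x A \<in> F}"
    using assms[of A "insert x A"] set_pmf_random_subset[of X p] by auto
qed simp

lemma convex_comb_mono:
  fixes a b c d p q :: real
  assumes "a \<le> c" "b \<le> d" "b \<le> a" "0 \<le> p" "p \<le> q" "q \<le> 1"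
  shows "p * a + (1 - p) * b \<le> q * c + (1 - q) * d"
proof -
  have "p * a + (1 - p) * b \<le> q * a + (1 - q) * b"
    using mult_right_mono[of p q "a - b"] assms by (simp add: algebra_simps)
  also have "\<dots> \<le> q * c + (1 - q) * d"
    using assms by (intro add_mono mult_left_mono) auto
  finally show ?thesis .
qed

text \<open>Strictness has two sources: if \<open>b < d\<close>, the second value grows and keeps
  the positive weight \<open>1 - q\<close>; if \<open>b < a\<close>, shifting weight from
  \<open>b\<close> to \<open>a\<close> already gains.\<close>

lemma convex_comb_strict_mono:
  fixes a b c d p q :: real
  assumes "a \<le> c" "b \<le> d" "b \<le> a" "0 \<le> p" "p < q" "q < 1" "b < d \<or> b < a"
  shows "p * a + (1 - p) * b < q * c + (1 - q) * d"
  using assms(7)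
proof
  assume "b < d"
  have "p * a + (1 - p) * b \<le> q * c + (1 - q) * b"
    using assms by (intro convex_comb_mono) auto
  also have "\<dots> < q * c + (1 - q) * d"
    using \<open>b < d\<close> assms by simp
  finally show ?thesis .
next
  assume "b < a"
  have "p * a + (1 - p) * b < q * a + (1 - q) * b"
    using mult_strict_right_mono[of p q "a - b"] \<open>b < a\<close> assms by (simp add: algebra_simps)
  also have "\<dots> \<le> q * c + (1 - q) * d"
    using assms by (intro add_mono mult_left_mono) auto
  finally show ?thesis .
qed

text \<open>The family may contain sets outside \<open>Pow X\<close> and is closed upwards only
  within \<open>X\<close>. In this form the induction can use the same \<open>F\<close>, as well as
  its link, over the smaller ground set.\<close>

lemma prob_random_subset_mono:
  assumes "finite X" "0 \<le> p" "p \<le> q" "q \<le> 1"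
    and "\<And>A B. A \<in> F \<Longrightarrow> A \<subseteq> B \<Longrightarrow> B \<subseteq> X \<Longrightarrow> B \<in> F"
  shows "measure_pmf.prob (random_subset X p) F \<le> measure_pmf.prob (random_subset X q) F"
  using assms(1,5)
proof (induction X arbitrary: F)
  case empty
  then show ?case by simp
next
  case (insert x X)
  let ?P = "\<lambda>p. measure_pmf.prob (random_subset X p)"
  let ?F1 = "{A. insert x A \<in> F}"
  have "?P p F \<le> ?P q F"
    using insert.prems by (intro insert.IH) auto
  moreover have "?P p ?F1 \<le> ?P q ?F1"
  proof (rule insert.IH)
    fix A B assume "A \<in> ?F1" "A \<subseteq> B" "B \<subseteq> X"
    then show "B \<in> ?F1"
      using insert.prems[of "insert x A" "insert x B"] by auto
  qed
  moreover have "?P p F \<le> ?P p ?F1"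
    by (rule prob_random_subset_le_link) (fact insert.prems)
  ultimately show ?case
    using insert.hyps assms by (simp add: prob_random_subset_insert convex_comb_mono)
qed

lemma prob_random_subset_strict_mono:
  assumes "finite X" "0 < p" "p < q" "q < 1"
    and "\<And>A B. A \<in> F \<Longrightarrow> A \<subseteq> B \<Longrightarrow> B \<subseteq> X \<Longrightarrow> B \<in> F" "{} \<notin> F" "X \<in> F"
  shows "measure_pmf.prob (random_subset X p) F < measure_pmf.prob (random_subset X q) F"
  using assms(1,5-7)
proof (induction X arbitrary: F)
  case empty
  then show ?case by simp
next
  case (insert x X)
  let ?P = "\<lambda>p. measure_pmf.prob (random_subset X p)"
  let ?F1 = "{A. insert x A \<in> F}"
  have up: "A \<in> F \<Longrightarrow> A \<subseteq> B \<Longrightarrow> B \<subseteq> insert x X \<Longrightarrow> B \<in> F" for A B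
    by (fact insert.prems)
  have "?P p F \<le> ?P q F"
    using insert.hyps assms(2-4) up by (intro prob_random_subset_mono) (simp_all, blast)
  moreover have "?P p ?F1 \<le> ?P q ?F1"
  proof (rule prob_random_subset_mono)
    fix A B assume "A \<in> ?F1" "A \<subseteq> B" "B \<subseteq> X"
    then show "B \<in> ?F1"
      using up[of "insert x A" "insert x B"] by auto
  qed (use insert.hyps assms in auto)
  moreover have le: "?P p F \<le> ?P p ?F1"
    by (rule prob_random_subset_le_link) (fact up)
  moreover have "?P p F < ?P q F \<or> ?P p F < ?P p ?F1"
  \<comment> \<open>If \<open>X \<in> F\<close>, induction gives strict growth for \<open>F\<close>.
    Otherwise \<open>X\<close> lies in the link but not in \<open>F\<close>, and its mass
    \<open>p ^ card X > 0\<close> separates the two. Induction is never applied to the link, which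
    may contain the empty set.\<close>
  proof (cases "X \<in> F")
    case True
    have "?P p F < ?P q F"
      using up \<open>{} \<notin> F\<close> True by (intro insert.IH) auto
    then show ?thesis ..
  next
    case False
    have "?P p F + pmf (random_subset X p) X = ?P p (F \<union> {X})"
      using False by (subst measure_pmf.finite_measure_Union) (auto simp: measure_pmf_single)
    also have "\<dots> \<le> ?P p ?F1"
    proof (intro measure_pmf.finite_measure_mono_AE AE_pmfI impI)
      fix A assume "A \<in> set_pmf (random_subset X p)" "A \<in> F \<union> {X}"
      then show "A \<in> ?F1"
        using up[of A "insert x A"] set_pmf_random_subset[of X p] \<open>insert x X \<in> F\<close> by auto
    qed simp
    finally have "?P p F + p ^ card X \<le> ?P p ?F1"
      using insert.hyps assms by (simp add: pmf_random_subset)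
    then show ?thesis
      using zero_less_power[OF \<open>0 < p\<close>, of "card X"] by linarith
  qed
  ultimately show ?case
    using insert.hyps assms by (simp add: prob_random_subset_insert convex_comb_strict_mono)
qed

lemma empty_notin_nontrivial:
  assumes "increasing_family X F" "nontrivial_family X F"
  shows "{} \<notin> F"
  using assms unfolding increasing_family_def nontrivial_family_def by blast

lemma ground_in_nontrivial:
  assumes "increasing_family X F" "nontrivial_family X F"
  shows "X \<in> F"
  using assms unfolding increasing_family_def nontrivial_family_def by blast

lemma threshold_unique:
  assumes "finite X" "increasing_family X F" "nontrivial_family X F"
    and "0 < p" "p < 1" "measure_pmf.prob (random_subset X p) F = 1 / 2"
    and "0 < q" "q < 1" "measure_pmf.prob (random_subset X q) F = 1 / 2"
  shows "p = q"
proof -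
  have "measure_pmf.prob (random_subset X r) F < measure_pmf.prob (random_subset X s) F"
    if "0 < r" "r < s" "s < 1" for r s
    using that assms empty_notin_nontrivial[OF assms(2,3)] ground_in_nontrivial[OF assms(2,3)]
    by (intro prob_random_subset_strict_mono) (auto simp: increasing_family_def)
  from this[of p q] this[of q p] show ?thesis
    using assms by (cases p q rule: linorder_cases) auto
qed

text \<open>The probability is a polynomial \<open>g\<close> in \<open>p\<close>. It vanishes at 0
  because all members of \<open>F\<close> are nonempty, and equals 1 at 1 because
  \<open>X \<in> F\<close>; the intermediate value theorem does the rest.\<close>

lemma threshold_exists:
  assumes "finite X" "increasing_family X F" "nontrivial_family X F"
  obtains p where "0 < p" "p < 1" "measure_pmf.prob (random_subset X p) F = 1 / 2"
proof -
  define g where "g p = (\<Sum>A\<in>F. p ^ card A * (1 - p) ^ card (X - A))" for p :: real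
  have sub: "F \<subseteq> Pow X"
    using assms by (auto simp: increasing_family_def)
  then have fin: "finite F"
    using assms finite_subset by blast
  have g: "measure_pmf.prob (random_subset X p) F = g p" if "0 \<le> p" "p \<le> 1" for p
    unfolding g_def measure_measure_pmf_finite[OF fin]
    using that sub assms by (intro sum.cong refl pmf_random_subset) auto
  have "card A \<noteq> 0" if "A \<in> F" for A
    using that sub empty_notin_nontrivial[OF assms(2,3)] finite_subset[OF _ assms(1), of A]
    by (auto simp: card_eq_0_iff)
  then have g0: "g 0 = 0"
    unfolding g_def by (intro sum.neutral) (simp add: power_0_left)
  have "1 = pmf (random_subset X 1) X"
    using assms by (simp add: pmf_random_subset)
  also have "\<dots> \<le> measure_pmf.prob (random_subset X 1) F"
    using ground_in_nontrivial[OF assms(2,3)]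
    by (auto simp flip: measure_pmf_single intro!: measure_pmf.finite_measure_mono)
  finally have "1 \<le> g 1"
    by (simp add: g)
  then have g1: "g 1 = 1"
    using g[of 1] measure_pmf.prob_le_1[of "random_subset X 1" F] by simp
  have "continuous_on {0..1} g"
    unfolding g_def by (intro continuous_intros)
  then obtain p where p: "0 \<le> p" "p \<le> 1" "g p = 1 / 2"
    using IVT'[of g 0 "1 / 2" 1] g0 g1 by auto
  then have "p \<noteq> 0" "p \<noteq> 1"
    using g0 g1 by auto
  with p show thesis
    using that[of p] g[of p] by auto
qed

lemma
  assumes "finite X" "increasing_family X F" "nontrivial_family X F"
  shows threshold_pos: "0 < threshold X F"
    and threshold_less_one: "threshold X F < 1"
    and prob_threshold: "measure_pmf.prob (random_subset X (threshold X F)) F = 1 / 2"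
proof -
  let ?P = "\<lambda>p. 0 < p \<and> p < 1 \<and> measure_pmf.prob (random_subset X p) F = 1 / 2"
  have "\<exists>!p. ?P p"
    using threshold_exists[OF assms] threshold_unique[OF assms] by metis
  then have "?P (threshold X F)"
    unfolding threshold_def by (rule theI')
  then show "0 < threshold X F" "threshold X F < 1"
    "measure_pmf.prob (random_subset X (threshold X F)) F = 1 / 2"
    by auto
qed

section \<open>Blowing up the ground set\<close>

text \<open>The copies are given by a map \<open>\<pi>\<close> with all fibres of size
  \<open>N\<close> rather than by a product set, so that \<open>Y\<close> can later be taken among
  the natural numbers whatever the type of \<open>X\<close>.\<close>

locale blowup =
  fixes X :: "'a set" and Y :: "'b set" and \<pi> :: "'b \<Rightarrow> 'a" and N :: nat
  assumes finite_X: "finite X" and finite_Y: "finite Y"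
    and proj: "y \<in> Y \<Longrightarrow> \<pi> y \<in> X"
    and card_fibre: "x \<in> X \<Longrightarrow> card {y \<in> Y. \<pi> y = x} = N"
    and N_pos: "N > 0"
begin

definition lift :: "'a set set \<Rightarrow> 'b set set" where
  "lift F = {S. S \<subseteq> Y \<and> \<pi> ` S \<in> F}"

lemma fibre_nonempty: "x \<in> X \<Longrightarrow> \<exists>y\<in>Y. \<pi> y = x"
  using card_fibre[of x] N_pos by (metis (mono_tags, lifting) card.empty empty_Collect_eq less_irrefl)

lemma proj_image: "\<pi> ` Y = X"
  using proj fibre_nonempty by blast

lemma increasing_lift:
  assumes "increasing_family X F"
  shows "increasing_family Y (lift F)"
  unfolding increasing_family_def
proof (intro conjI allI impI)
  fix A B assume "A \<in> lift F" "A \<subseteq> B" "B \<subseteq> Y"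
  moreover from this have "\<pi> ` A \<subseteq> \<pi> ` B" "\<pi> ` B \<subseteq> X"
    using proj by auto
  ultimately show "B \<in> lift F"
    using assms unfolding increasing_family_def lift_def by blast
qed (auto simp: lift_def)

lemma nontrivial_lift:
  assumes "increasing_family X F" "nontrivial_family X F"
  shows "nontrivial_family Y (lift F)"
proof -
  have "Y \<in> lift F" "{} \<notin> lift F"
    using ground_in_nontrivial[OF assms] empty_notin_nontrivial[OF assms]
    by (auto simp: lift_def proj_image)
  then show ?thesis
    unfolding nontrivial_family_def by blast
qed

text \<open>Fibres are disjoint, hence independent, and \<open>x\<close> lies in the projection iff
  its fibre is hit, which has probability \<open>1 - (1 - p) ^ N\<close>. Induction over
  \<open>Z\<close> adds one fibre at a time.\<close>

lemma map_image_random_subset: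
  assumes "0 \<le> p" "p \<le> 1" "Z \<subseteq> X"
  shows "map_pmf ((`) \<pi>) (random_subset {y \<in> Y. \<pi> y \<in> Z} p) = random_subset Z (1 - (1 - p) ^ N)"
proof -
  have "finite Z"
    using assms finite_X finite_subset by blast
  then show ?thesis
    using assms(3)
  proof (induction Z)
    case empty
    then show ?case by simp
  next
    case (insert x Z)
    let ?r = "1 - (1 - p) ^ N"
    let ?A = "{y \<in> Y. \<pi> y = x}" and ?B = "{y \<in> Y. \<pi> y \<in> Z}"
    have fib: "map_pmf ((`) \<pi>) (random_subset ?A p) = random_subset {x} ?r"
    proof -
      have "map_pmf ((`) \<pi>) (random_subset ?A p) =
        map_pmf (\<lambda>b. if b then {x} else {}) (map_pmf (\<lambda>S. S \<noteq> {}) (random_subset ?A p))"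
        unfolding map_pmf_comp
        using set_pmf_random_subset[of ?A p] by (intro map_pmf_cong refl) auto
      also have "\<dots> = random_subset {x} ?r"
        using insert.prems assms finite_Y card_fibre
        by (simp add: map_nonempty_random_subset random_subset_singleton)
      finally show ?thesis .
    qed
    have "{y \<in> Y. \<pi> y \<in> insert x Z} = ?A \<union> ?B"
      by auto
    then have "random_subset {y \<in> Y. \<pi> y \<in> insert x Z} p =
      map_pmf (\<lambda>(S, T). S \<union> T) (pair_pmf (random_subset ?A p) (random_subset ?B p))"
      using finite_Y insert.hyps by (auto intro!: random_subset_Un)
    then have "map_pmf ((`) \<pi>) (random_subset {y \<in> Y. \<pi> y \<in> insert x Z} p) =
      map_pmf (\<lambda>(S, T). S \<union> T)
        (map_pmf (\<lambda>(S, T). (\<pi> ` S, \<pi> ` T)) (pair_pmf (random_subset ?A p) (random_subset ?B p)))"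
      by (simp add: map_pmf_comp case_prod_unfold image_Un)
    also have "\<dots> = map_pmf (\<lambda>(S, T). S \<union> T) (pair_pmf (random_subset {x} ?r) (random_subset Z ?r))"
      using insert.IH insert.prems by (simp only: map_pair fib) simp
    also have "\<dots> = random_subset (insert x Z) ?r"
      using random_subset_Un[of "{x}" Z ?r] insert.hyps by simp
    finally show ?case .
  qed
qed

lemma prob_lift:
  assumes "0 \<le> p" "p \<le> 1"
  shows "measure_pmf.prob (random_subset Y p) (lift F) =
    measure_pmf.prob (random_subset X (1 - (1 - p) ^ N)) F"
proof -
  have "{y \<in> Y. \<pi> y \<in> X} = Y"
    using proj by auto
  then have "random_subset X (1 - (1 - p) ^ N) = map_pmf ((`) \<pi>) (random_subset Y p)"
    using map_image_random_subset[OF assms order_refl] by simp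
  moreover have "measure_pmf.prob (random_subset Y p) (lift F) =
    measure_pmf.prob (random_subset Y p) ((`) \<pi> -` F)"
    using set_pmf_random_subset[of Y p]
    by (intro measure_pmf.finite_measure_eq_AE AE_pmfI) (auto simp: lift_def)
  ultimately show ?thesis
    by simp
qed

text \<open>At \<open>1 - (1 - ?p) ^ N\<close>, a point of the open unit interval, \<open>F\<close>
  has probability 1/2 by \<open>prob_lift\<close>; uniqueness identifies it with the threshold of
  \<open>F\<close>.\<close>

lemma threshold_lift:
  assumes "increasing_family X F" "nontrivial_family X F"
  shows "1 - threshold X F = (1 - threshold Y (lift F)) ^ N"
proof -
  note Y = finite_Y increasing_lift[OF assms(1)] nontrivial_lift[OF assms]
  note X = finite_X assms
  let ?p = "threshold Y (lift F)"
  have p: "0 < ?p" "?p < 1"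
    using threshold_pos[OF Y] threshold_less_one[OF Y] by auto
  have r: "0 < 1 - (1 - ?p) ^ N" "1 - (1 - ?p) ^ N < 1"
    using p N_pos by (auto simp: power_less_one_iff)
  have "threshold X F = 1 - (1 - ?p) ^ N"
  proof (rule threshold_unique[OF X])
    show "measure_pmf.prob (random_subset X (1 - (1 - ?p) ^ N)) F = 1 / 2"
      using prob_threshold[OF Y] prob_lift[of ?p F] p by simp
  qed (use r threshold_pos[OF X] threshold_less_one[OF X] prob_threshold[OF X] in auto)
  then show ?thesis
    by simp
qed

section \<open>Minimal elements of the lifted family\<close>

lemma minimal_liftD:
  assumes "S \<in> minimal_elements (lift F)"
  shows "inj_on \<pi> S" "\<pi> ` S \<in> minimal_elements F"
proof -
  have S: "S \<subseteq> Y" "\<pi> ` S \<in> F"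
    and min: "\<And>B. B \<in> lift F \<Longrightarrow> B \<subseteq> S \<Longrightarrow> B = S"
    using assms by (auto simp: minimal_elements_def lift_def)
  \<comment> \<open>Keep one copy per projected point. The smaller set \<open>U\<close> is still in
    the lift, so minimality forces \<open>U = S\<close>.\<close>
  obtain U where U: "U \<subseteq> S" "inj_on \<pi> U" "\<pi> ` S = \<pi> ` U"
    using subset_image_inj[of "\<pi> ` S" \<pi> S] by auto
  then have "U \<in> lift F"
    using S by (auto simp: lift_def)
  then show "inj_on \<pi> S"
    using U min by metis
  \<comment> \<open>The part of \<open>S\<close> lying over \<open>B\<close> projects onto
    \<open>B\<close>, so it belongs to the lift and must be all of \<open>S\<close>.\<close>
  have "B = \<pi> ` S" if "B \<in> F" "B \<subseteq> \<pi> ` S" for B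
  proof -
    have img: "\<pi> ` {y \<in> S. \<pi> y \<in> B} = B"
      using that by auto
    then have "{y \<in> S. \<pi> y \<in> B} \<in> lift F"
      using that S by (auto simp: lift_def)
    then have "{y \<in> S. \<pi> y \<in> B} = S"
      by (rule min) auto
    with img show ?thesis
      by simp
  qed
  then show "\<pi> ` S \<in> minimal_elements F"
    using S by (auto simp: minimal_elements_def)
qed

text \<open>Copy \<open>A\<close> by a choice \<open>s\<close> of one copy per point. A member of
  the lift inside this copy projects into \<open>A\<close>, hence onto \<open>A\<close> by
  minimality, and so contains every chosen copy.\<close>

lemma minimal_liftI:
  assumes "A \<in> minimal_elements F" "A \<subseteq> X"
  shows "\<exists>S\<in>minimal_elements (lift F). card S = card A"
proof -
  obtain s where s: "\<And>x. x \<in> X \<Longrightarrow> s x \<in> Y \<and> \<pi> (s x) = x"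
    using fibre_nonempty by metis
  have img: "\<pi> ` s ` A = A"
    using s assms by force
  have "s ` A \<in> minimal_elements (lift F)"
    unfolding minimal_elements_def
  proof (intro CollectI conjI ballI impI)
    show "s ` A \<in> lift F"
      using img s assms by (auto simp: lift_def minimal_elements_def)
    fix B assume B: "B \<in> lift F" "B \<subseteq> s ` A"
    have "\<pi> ` B \<subseteq> A"
      using B img by blast
    then have "\<pi> ` B = A"
      using B assms by (auto simp: lift_def minimal_elements_def)
    moreover have "s (\<pi> y) = y" if "y \<in> B" for y
      using that B s assms by force
    ultimately show "B = s ` A"
      by force
  qed
  moreover have "card (s ` A) = card A"
    using s assms by (intro card_image inj_on_inverseI[where g = \<pi>]) auto
  ultimately show ?thesis
    by blast
qed

lemma largest_minimal_size_lift:
  assumes "F \<subseteq> Pow X"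
  shows "largest_minimal_size (lift F) = largest_minimal_size F"
proof -
  have "card ` minimal_elements (lift F) = card ` minimal_elements F"
  proof (intro equalityI subsetI)
    fix n assume "n \<in> card ` minimal_elements (lift F)"
    then show "n \<in> card ` minimal_elements F"
      using minimal_liftD by (force simp: card_image)
  next
    fix n assume "n \<in> card ` minimal_elements F"
    then obtain A where "A \<in> minimal_elements F" "n = card A"
      by blast
    moreover from this have "A \<subseteq> X"
      using assms by (auto simp: minimal_elements_def)
    ultimately show "n \<in> card ` minimal_elements (lift F)"
      using minimal_liftI by (metis imageI)
  qed
  then show ?thesis
    by (simp add: largest_minimal_size_def)
qed

section \<open>Random sections of \<open>\<pi>\<close> and projected covers\<close>

definition sections :: "('a \<Rightarrow> 'b) set" where
  "sections = (\<Pi>\<^sub>E x\<in>X. {y \<in> Y. \<pi> y = x})"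

lemma finite_sections: "finite sections"
  unfolding sections_def using finite_X finite_Y by (intro finite_PiE) auto

lemma card_sections: "card sections = N ^ card X"
  unfolding sections_def using finite_X by (simp add: card_PiE card_fibre)

lemma sectionsD:
  assumes "f \<in> sections" "x \<in> X"
  shows "f x \<in> Y" "\<pi> (f x) = x"
  using assms by (auto simp: sections_def PiE_iff)

lemma inj_on_section_image:
  assumes "f \<in> sections"
  shows "inj_on \<pi> (f ` X)"
  using sectionsD[OF assms] by (intro inj_on_inverseI[where g = f]) auto

text \<open>A uniformly random section passes through \<open>S\<close> with probability at most
  \<open>1 / N ^ card S\<close>: its values over the projection of \<open>S\<close> are forced. If
  \<open>\<pi>\<close> is not injective on \<open>S\<close>, no section passes through it.\<close>

lemma card_sections_through:
  assumes "S \<subseteq> Y"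
  shows "card {f \<in> sections. S \<subseteq> f ` X} * N ^ card S \<le> N ^ card X"
proof (cases "inj_on \<pi> S")
  case True
  have sub: "\<pi> ` S \<subseteq> X" and finS: "finite S"
    using assms proj finite_Y finite_subset by auto
  \<comment> \<open>\<open>?T x\<close> is the set of values left at \<open>x\<close>: a single
    point over the projection of \<open>S\<close>, the whole fibre elsewhere.\<close>
  let ?T = "\<lambda>x. if x \<in> \<pi> ` S then {y \<in> S. \<pi> y = x} else {y \<in> Y. \<pi> y = x}"
  have "{f \<in> sections. S \<subseteq> f ` X} \<subseteq> Pi\<^sub>E X ?T"
  proof
    fix f assume f: "f \<in> {f \<in> sections. S \<subseteq> f ` X}"
    have "f (\<pi> y) = y" if "y \<in> S" for y
      using f that sectionsD[of f] by force
    then show "f \<in> Pi\<^sub>E X ?T"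
      using f by (auto simp: sections_def PiE_iff)
  qed
  moreover have "finite (Pi\<^sub>E X ?T)"
    using finite_X finite_Y finS by (intro finite_PiE) auto
  ultimately have "card {f \<in> sections. S \<subseteq> f ` X} \<le> card (Pi\<^sub>E X ?T)"
    by (rule card_mono[rotated])
  also have "\<dots> = (\<Prod>x\<in>X. card (?T x))"
    using finite_X by (rule card_PiE)
  also have "\<dots> = (\<Prod>x\<in>X. if x \<in> \<pi> ` S then 1 else N)"
  proof (rule prod.cong)
    fix x assume "x \<in> X"
    show "card (?T x) = (if x \<in> \<pi> ` S then 1 else N)"
    proof (cases "x \<in> \<pi> ` S")
      case x: True
      then obtain y where "y \<in> S" "\<pi> y = x"
        by blast
      then have "{y \<in> S. \<pi> y = x} = {y}"
        using True by (auto dest: inj_onD)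
      with x show ?thesis
        by simp
    qed (use \<open>x \<in> X\<close> card_fibre in simp)
  qed simp
  also have "\<dots> = N ^ card (X - \<pi> ` S)"
    using finite_X by (simp add: prod.If_cases Diff_eq)
  also have "card (X - \<pi> ` S) = card X - card S"
    using sub finS True by (simp add: card_Diff_subset card_image)
  finally have "card {f \<in> sections. S \<subseteq> f ` X} * N ^ card S \<le> N ^ (card X - card S) * N ^ card S"
    by (rule mult_right_mono) simp
  moreover have "card S \<le> card X"
    using True sub finite_X by (metis card_image card_mono)
  ultimately show ?thesis
    by (simp flip: power_add)
next
  case False
  then have none: "{f \<in> sections. S \<subseteq> f ` X} = {}"
    using inj_on_section_image inj_on_subset by blast
  show ?thesis
    unfolding none by simp
qed

text \<open>First-moment argument: for a random section keep the members of \<open>G\<close> inside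
  its image and project them. Each \<open>S\<close> survives with probability at most
  \<open>1 / N ^ card S\<close>, which offsets the factor \<open>N ^ card S\<close> gained at
  \<open>N * q\<close>. Some section does no worse than average.\<close>

lemma project_cover:
  fixes q :: real
  assumes "0 \<le> q" "G \<subseteq> Pow Y" "covers G (lift F)" "F \<subseteq> Pow X"
  obtains H where "H \<subseteq> Pow X" "covers H F" "cost (N * q) H \<le> cost q G"
proof -
  define H where "H f = (`) \<pi> ` {S \<in> G. S \<subseteq> f ` X}" for f
  have finG: "finite G"
    using assms finite_Y finite_subset by blast
  \<comment> \<open>The copy of \<open>T\<close> under \<open>f\<close> lies in the lift, so it
    contains some \<open>S \<in> G\<close>. This \<open>S\<close> is kept in the image of
    \<open>f\<close> and projects into \<open>T\<close>.\<close>
  have cov: "covers (H f) F" if f: "f \<in> sections" for f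
    unfolding covers_def
  proof
    fix T assume "T \<in> F"
    then have "T \<subseteq> X"
      using assms by auto
    then have img: "\<pi> ` f ` T = T"
      using sectionsD[OF f] by force
    have "f ` T \<subseteq> Y"
      using \<open>T \<subseteq> X\<close> sectionsD[OF f] by auto
    then have "f ` T \<in> lift F"
      using img \<open>T \<in> F\<close> by (auto simp: lift_def)
    then obtain S where S: "S \<in> G" "S \<subseteq> f ` T"
      using assms by (auto simp: covers_def)
    then have "\<pi> ` S \<in> H f"
      unfolding H_def using \<open>T \<subseteq> X\<close> by blast
    moreover have "\<pi> ` S \<subseteq> T"
      using S img by blast
    ultimately show "\<exists>S\<in>H f. S \<subseteq> T"
      by blast
  qed
  have sub: "H f \<subseteq> Pow X" for f
    using assms proj by (auto simp: H_def)
  have cost_H: "cost (N * q) (H f) \<le> (\<Sum>S\<in>G. if S \<subseteq> f ` X then (N * q) ^ card S else 0)"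
    if f: "f \<in> sections" for f
  proof -
    have "cost (N * q) (H f) \<le> (\<Sum>S | S \<in> G \<and> S \<subseteq> f ` X. (N * q) ^ card (\<pi> ` S))"
      unfolding cost_def H_def
      using sum_image_le[of "{S \<in> G. S \<subseteq> f ` X}" "\<lambda>S. (N * q) ^ card S" "(`) \<pi>"]
        finG assms by (simp add: o_def)
    also have "\<dots> = (\<Sum>S | S \<in> G \<and> S \<subseteq> f ` X. (N * q) ^ card S)"
    proof (rule sum.cong)
      fix S assume "S \<in> {S. S \<in> G \<and> S \<subseteq> f ` X}"
      then have "inj_on \<pi> S"
        using inj_on_section_image[OF f] inj_on_subset by blast
      then show "(N * q) ^ card (\<pi> ` S) = (N * q) ^ card S"
        by (simp add: card_image)
    qed simp
    also have "\<dots> = (\<Sum>S\<in>G. if S \<subseteq> f ` X then (N * q) ^ card S else 0)"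
      using finG by (simp add: sum.inter_filter)
    finally show ?thesis .
  qed
  have "(\<Sum>f\<in>sections. cost (N * q) (H f))
    \<le> (\<Sum>f\<in>sections. \<Sum>S\<in>G. if S \<subseteq> f ` X then (N * q) ^ card S else 0)"
    by (intro sum_mono cost_H)
  also have "\<dots> = (\<Sum>S\<in>G. \<Sum>f\<in>sections. if S \<subseteq> f ` X then (N * q) ^ card S else 0)"
    by (rule sum.swap)
  \<comment> \<open>The inner sum counts sections through \<open>S\<close>; splitting off
    \<open>N ^ card S\<close> gives the product bounded by
    \<open>card_sections_through\<close>.\<close>
  also have "\<dots> = (\<Sum>S\<in>G. real (card {f \<in> sections. S \<subseteq> f ` X} * N ^ card S) * q ^ card S)"
    using finite_sections by (simp add: power_mult_distrib mult.assoc flip: sum.inter_filter)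
  also have "\<dots> \<le> (\<Sum>S\<in>G. real (N ^ card X) * q ^ card S)"
  proof (intro sum_mono mult_right_mono)
    fix S assume "S \<in> G"
    then show "real (card {f \<in> sections. S \<subseteq> f ` X} * N ^ card S) \<le> real (N ^ card X)"
      using assms card_sections_through[of S] by (intro of_nat_mono) auto
  qed (use assms in auto)
  also have "\<dots> = (\<Sum>f\<in>sections. cost q G)"
    by (simp add: cost_def card_sections flip: sum_distrib_left)
  finally have le: "(\<Sum>f\<in>sections. cost (N * q) (H f)) \<le> (\<Sum>f\<in>sections. cost q G)" .
  have ne: "sections \<noteq> {}"
    using card_sections N_pos by auto
  have "\<exists>f\<in>sections. cost (N * q) (H f) \<le> cost q G"
  proof (rule ccontr)
    assume "\<not> ?thesis"
    then have "(\<Sum>f\<in>sections. cost q G) < (\<Sum>f\<in>sections. cost (N * q) (H f))"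
      using ne finite_sections by (intro sum_strict_mono) auto
    with le show False
      by simp
  qed
  then show thesis
    using that cov sub by blast
qed

text \<open>Whenever \<open>q\<close> admits a cheap cover of the lift, \<open>N * q\<close> admits
  one of \<open>F\<close> by \<open>project_cover\<close>; then pass to suprema.\<close>

lemma expectation_threshold_lift:
  assumes "increasing_family X F" "nontrivial_family X F"
  shows "N * expectation_threshold Y (lift F) \<le> expectation_threshold X F"
proof -
  have sub: "F \<subseteq> Pow X"
    using assms by (auto simp: increasing_family_def)
  have "expectation_threshold Y (lift F) \<le> expectation_threshold X F / N"
    unfolding expectation_threshold_def[of Y]
  proof (rule cSup_least)
    \<comment> \<open>The supremum is over a nonempty set: at \<open>q = 0\<close> the lift covers
      itself at cost 0, having only nonempty members.\<close>
    have "card A \<noteq> 0" if "A \<in> lift F" for A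
      using that empty_notin_nontrivial[OF assms] finite_subset[OF _ finite_Y, of A]
      by (auto simp: lift_def card_eq_0_iff)
    then have "cost 0 (lift F) = 0"
      unfolding cost_def by (intro sum.neutral) (simp add: power_0_left)
    moreover have "covers (lift F) (lift F)" "lift F \<subseteq> Pow Y"
      by (auto simp: covers_def lift_def)
    ultimately have "0 \<in> {q \<in> {0..1}. \<exists>G. G \<subseteq> Pow Y \<and> cheap q G \<and> covers G (lift F)}"
      by (intro CollectI conjI exI[of _ "lift F"]) (simp_all add: cheap_def)
    then show "{q \<in> {0..1}. \<exists>G. G \<subseteq> Pow Y \<and> cheap q G \<and> covers G (lift F)} \<noteq> {}"
      by blast
  next
    fix q assume "q \<in> {q \<in> {0..1}. \<exists>G. G \<subseteq> Pow Y \<and> cheap q G \<and> covers G (lift F)}"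
    then obtain G where q: "0 \<le> q" "q \<le> 1" and G: "G \<subseteq> Pow Y" "cheap q G" "covers G (lift F)"
      by auto
    obtain H where H: "H \<subseteq> Pow X" "covers H F" "cost (N * q) H \<le> cost q G"
      using project_cover[OF q(1) G(1,3) sub] .
    have cheap: "cost (N * q) H \<le> 1 / 2"
      using H G by (simp add: cheap_def)
    \<comment> \<open>Admissible values must lie in the unit interval. If \<open>N * q > 1\<close>,
      each member of \<open>H\<close> would cost at least 1, so \<open>H\<close> would be empty and
      could not cover \<open>X \<in> F\<close>.\<close>
    have "N * q \<le> 1"
    proof (rule ccontr)
      assume "\<not> ?thesis"
      then have "(\<Sum>S\<in>H. 1) \<le> cost (N * q) H"
        unfolding cost_def by (intro sum_mono one_le_power) auto
      then have "card H = 0"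
        using cheap by simp
      moreover have "finite H"
        using H finite_X finite_subset by blast
      ultimately have "H = {}"
        by simp
      then show False
        using H ground_in_nontrivial[OF assms] by (auto simp: covers_def)
    qed
    then have "N * q \<in> {q \<in> {0..1}. \<exists>G. G \<subseteq> Pow X \<and> cheap q G \<and> covers G F}"
      using q H cheap by (intro CollectI conjI exI[of _ H]) (simp_all add: cheap_def)
    then have "N * q \<le> expectation_threshold X F"
      unfolding expectation_threshold_def by (rule cSup_upper) (auto intro: bdd_aboveI[of _ 1])
    then show "q \<le> expectation_threshold X F / N"
      using N_pos by (simp add: field_simps)
  qed
  then show ?thesis
    using N_pos by (simp add: field_simps)
qed

end

section \<open>Copies as natural numbers, and the limit of many copies\<close>

lemma blowup_nat_exists:
  assumes "finite X" "N > 0"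
  obtains Y :: "nat set" and \<pi> where "blowup X Y \<pi> N"
proof -
  obtain e where e: "bij_betw e {..<card X} X"
    using ex_bij_betw_nat_finite[OF assms(1)] by (auto simp: atLeast0LessThan)
  \<comment> \<open>The copies of the \<open>i\<close>-th point of \<open>X\<close> form the block
    \<open>{i * N..<i * N + N}\<close>, on which \<open>k div N = i\<close>.\<close>
  have "blowup X {..<card X * N} (\<lambda>k. e (k div N)) N"
  proof
    fix k assume "k \<in> {..<card X * N}"
    then have "k div N < card X"
      by (simp add: less_mult_imp_div_less)
    then show "e (k div N) \<in> X"
      using e by (auto dest: bij_betwE)
  next
    fix x assume "x \<in> X"
    then obtain i where i: "i < card X" "x = e i"
      using e by (auto simp: bij_betw_def)
    have "{k \<in> {..<card X * N}. e (k div N) = x} = {i * N..<i * N + N}"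
    proof (intro equalityI subsetI)
      fix k assume k: "k \<in> {k \<in> {..<card X * N}. e (k div N) = x}"
      then have "k div N < card X"
        by (simp add: less_mult_imp_div_less)
      then have "k div N = i"
        using k i e by (auto simp: bij_betw_def dest: inj_onD)
      then show "k \<in> {i * N..<i * N + N}"
        using assms dividend_less_div_times[of N k] by auto
    next
      fix k assume k: "k \<in> {i * N..<i * N + N}"
      then have "k div N = i"
        by (intro div_nat_eqI) (auto simp: mult.commute)
      moreover have "Suc i * N \<le> card X * N"
        using i by (intro mult_right_mono) auto
      ultimately show "k \<in> {k \<in> {..<card X * N}. e (k div N) = x}"
        using k i by auto
    qed
    then show "card {k \<in> {..<card X * N}. e (k div N) = x} = N"
      by simp
  qed (use assms in auto)
  then show thesis
    by (rule that)
qed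

theorem theorem1p2:
  fixes K :: real
  assumes "K > 0"
    and "\<And>(X :: nat set) (F :: nat set set).
           finite X \<Longrightarrow> increasing_family X F \<Longrightarrow> nontrivial_family X F \<Longrightarrow>
           largest_minimal_size F \<ge> 2 \<Longrightarrow>
           threshold X F \<le>
             K * expectation_threshold X F * log 2 (real (largest_minimal_size F))"
  shows "\<And>(X :: 'a set) (F :: 'a set set).
           finite X \<Longrightarrow> increasing_family X F \<Longrightarrow> nontrivial_family X F \<Longrightarrow>
           largest_minimal_size F \<ge> 2 \<Longrightarrow>
           threshold X F \<le>
             1 - exp (- (K * expectation_threshold X F * log 2 (real (largest_minimal_size F))))"
proof -
  fix X :: "'a set" and F :: "'a set set"
  assume X: "finite X" "increasing_family X F" "nontrivial_family X F"
    and l: "largest_minimal_size F \<ge> 2"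
  define L where "L = log 2 (real (largest_minimal_size F))"
  define c where "c = K * expectation_threshold X F * L"
  have "L \<ge> 0"
    using l by (simp add: L_def)
  \<comment> \<open>The condition \<open>c \<le> real N\<close> makes the base nonnegative, so that
    taking \<open>N\<close>-th powers preserves the inequality. The base is written as
    \<open>1 + - c / real N\<close> to match the limit formula for \<open>exp (- c)\<close>.\<close>
  have bound: "(1 + - c / real N) ^ N \<le> 1 - threshold X F" if N: "N > 0" "c \<le> real N" for N
  proof -
    obtain Y :: "nat set" and \<pi> where "blowup X Y \<pi> N"
      using blowup_nat_exists[OF X(1) N(1)] .
    then interpret blowup X Y \<pi> N .
    have l_eq: "largest_minimal_size (lift F) = largest_minimal_size F"
      using X by (intro largest_minimal_size_lift) (auto simp: increasing_family_def)
    have "threshold Y (lift F) \<le> K * expectation_threshold Y (lift F) * L"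
      using assms(2)[OF finite_Y increasing_lift[OF X(2)] nontrivial_lift[OF X(2,3)]] l
      by (simp add: l_eq L_def)
    also have "\<dots> \<le> K * (expectation_threshold X F / N) * L"
      using expectation_threshold_lift[OF X(2,3)] N \<open>K > 0\<close> \<open>L \<ge> 0\<close>
      by (intro mult_right_mono mult_left_mono) (auto simp: field_simps)
    also have "\<dots> = c / N"
      by (simp add: c_def)
    finally have "(1 - c / N) ^ N \<le> (1 - threshold Y (lift F)) ^ N"
      using N by (intro power_mono) auto
    then show ?thesis
      by (simp add: threshold_lift[OF X(2,3)])
  qed
  have "\<forall>\<^sub>F N in sequentially. (1 + - c / real N) ^ N \<le> 1 - threshold X F"
    using eventually_gt_at_top[of 0] eventually_ge_at_top[of "nat \<lceil>c\<rceil>"]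
    by eventually_elim (rule bound, auto)
  then have "exp (- c) \<le> 1 - threshold X F"
    using tendsto_exp_limit_sequentially[of "- c"] by (intro tendsto_upperbound) auto
  then show "threshold X F \<le>
    1 - exp (- (K * expectation_threshold X F * log 2 (real (largest_minimal_size F))))"
    by (simp add: c_def L_def)
qed

end
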